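(* Let $g<G$ and $\widehat m\ge 1$ be integers. Consider the one-dimensional reconstruction $P_{\mathrm{rec}}=\mathrm{CWENO}(P_{\mathrm{opt}},P_1,\ldots,P_{\widehat m})$ on a cell $\Omega_0$, with $P_{\mathrm{opt}}$ of degree $G$ and $P_1,\ldots,P_{\widehat m}$ of degree $g$, applied to the exact cell averages of a function $u$, and computed with the Jiang-Shu indicators and with $\epsilon=\hat\epsilon h^p$, where $\hat\epsilon>0$ is a constant independent of $h$ and $p\in\{1,2\}$. If $G\le 2g$, then the reconstruction is accurate of order $G+1$ on smooth functions, i.e. for every smooth $u$, $$u(x)-P_{\mathrm{rec}}(x)=\mathcal{O}(h^{G+1})\quad\text{as } h\to0,\ \text{ for } x\in\Omega_0 .$$
   Context: Setting. $\Omega_0$ is a cell of a one-dimensional grid, with centre $x_0=0$, and $h=\operatorname{diam}(\Omega_0)$ is the mesh size; asymptotics are for $h\to0$. $\mathbb{P}^n$ denotes the polynomials of degree at most $n$. The data are the exact cell averages $\overline{u}_j=\frac{1}{|\Omega_j|}\int_{\Omega_j}u\,\mathrm{d}x$ of a function $u$. The polynomial $P_{\mathrm{opt}}\in\mathbb{P}^G$ interpolates, in the sense of cell averages, the averages of $\Omega_0$ and of a suitable number of neighbours, so that for sufficiently regular $u$ one has $u(x)-P_{\mathrm{opt}}(x)=\mathcal{O}(h^{G+1})$ for $x\in\Omega_0$ (uniformly). The polynomials $P_1,\ldots,P_{\widehat m}\in\mathbb{P}^g$ each interpolate $g+1<G+1$ cell averages inside the stencil of $P_{\mathrm{opt}}$,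 and for sufficiently regular $u$ one has $u(x)-P_r(x)=\mathcal{O}(h^{g+1})$ for $x\in\Omega_0$ (uniformly). Jiang-Shu indicator of a polynomial $P$ on the cell $\Omega=\Omega_0$: $$I[P]=\sum_{l\ge1}\operatorname{diam}(\Omega)^{2l-1}\int_\Omega\Big(\tfrac{\mathrm{d}^l}{\mathrm{d}x^l}P(x)\Big)^2\mathrm{d}x .$$ Definition of CWENO. Fix positive real linear coefficients $d_0,\ldots,d_{\widehat m}\in[0,1]$ with $\sum_{k=0}^{\widehat m}d_k=1$ (independent of $h$), an exponent $t\ge2$, and $\epsilon>0$. (1) Set $P_0(x)=\frac1{d_0}\Big(P_{\mathrm{opt}}(x)-\sum_{k=1}^{\widehat m}d_kP_k(x)\Big)\in\mathbb{P}^G$. (2) For $k=0,\ldots,\widehat m$ set $\alpha_k=\dfrac{d_k}{(I[P_k]+\epsilon)^t}$ and $\omega_k=\dfrac{\alpha_k}{\sum_{i=0}^{\widehat m}\alpha_i}$. (3) Set $P_{\mathrm{rec}}(x)=\sum_{k=0}^{\widehat m}\omega_kP_k(x)\in\mathbb{P}^G$; this is $\mathrm{CWENO}(P_{\mathrm{opt}},P_1,\ldots,P_{\widehat m})$. *)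

theory Defs
  imports "HOL-Analysis.Analysis" "HOL-Computational_Algebra.Polynomial"
begin

definition smooth :: "(real \<Rightarrow> real) \<Rightarrow> bool" where
  "smooth u \<longleftrightarrow> (\<forall>n x. (deriv ^^ n) u differentiable (at x))"

definition cell :: "(int \<Rightarrow> real) \<Rightarrow> int \<Rightarrow> real set" where
  "cell e j = {e j..e (j + 1)}"

text \<open>
  A one-dimensional (in general non-uniform) grid is given by its strictly increasing cell
  interfaces. The cell \<open>0\<close> is centred at \<open>0\<close> and has diameter \<open>h\<close>. That \<open>h\<close> is the mesh size
  is expressed by the bound \<open>K * h\<close> on the diameter of all cells; \<open>K\<close> has to be the same for all
  members of a family of grids with \<open>h\<close> tending to \<open>0\<close>. There is no lower bound on the cell sizes.
\<close>
definition grid :: "real \<Rightarrow> real \<Rightarrow> (int \<Rightarrow> real) \<Rightarrow> bool" where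
  "grid K h e \<longleftrightarrow> strict_mono e \<and> e 0 = - h / 2 \<and> e 1 = h / 2 \<and>
     (\<forall>j. diameter (cell e j) \<le> K * h)"

definition cell_average :: "real set \<Rightarrow> (real \<Rightarrow> real) \<Rightarrow> real" where
  "cell_average \<Omega> u = integral \<Omega> u / measure lborel \<Omega>"

text \<open>
  \<open>p\<close> lies in the space of polynomials of degree at most \<open>n\<close> and reproduces the averages of \<open>u\<close>
  on the \<open>n + 1\<close> cells of the stencil \<open>S\<close>; this determines \<open>p\<close> uniquely.
\<close>
definition interpolates_averages ::
  "(int \<Rightarrow> real) \<Rightarrow> int set \<Rightarrow> nat \<Rightarrow> (real \<Rightarrow> real) \<Rightarrow> real poly \<Rightarrow> bool" where
  "interpolates_averages e S n u p \<longleftrightarrow> finite S \<and> card S = n + 1 \<and> degree p \<le> n \<and>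
     (\<forall>j\<in>S. cell_average (cell e j) (poly p) = cell_average (cell e j) u)"

text \<open>Only finitely many terms of the sum are nonzero.\<close>
definition jiang_shu :: "real set \<Rightarrow> real poly \<Rightarrow> real" where
  "jiang_shu \<Omega> p = (\<Sum>\<^sub>\<infinity>l\<in>{1..}. diameter \<Omega> ^ (2 * l - 1) *
     integral \<Omega> (\<lambda>x. (poly ((pderiv ^^ l) p) x)\<^sup>2))"

definition cweno_poly ::
  "(nat \<Rightarrow> real) \<Rightarrow> nat \<Rightarrow> real poly \<Rightarrow> (nat \<Rightarrow> real poly) \<Rightarrow> nat \<Rightarrow> real poly" where
  "cweno_poly d m Popt P k =
     (if k = 0 then smult (1 / d 0) (Popt - (\<Sum>i=1..m. smult (d i) (P i))) else P k)"

definition cweno_alpha ::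
  "real set \<Rightarrow> (nat \<Rightarrow> real) \<Rightarrow> real \<Rightarrow> real \<Rightarrow> (nat \<Rightarrow> real poly) \<Rightarrow> nat \<Rightarrow> real" where
  "cweno_alpha \<Omega> d t \<epsilon> Q k = d k / (jiang_shu \<Omega> (Q k) + \<epsilon>) powr t"

definition cweno_omega ::
  "real set \<Rightarrow> (nat \<Rightarrow> real) \<Rightarrow> nat \<Rightarrow> real \<Rightarrow> real \<Rightarrow> (nat \<Rightarrow> real poly) \<Rightarrow> nat \<Rightarrow> real" where
  "cweno_omega \<Omega> d m t \<epsilon> Q k =
     cweno_alpha \<Omega> d t \<epsilon> Q k / (\<Sum>i=0..m. cweno_alpha \<Omega> d t \<epsilon> Q i)"

text \<open>The argument \<open>P\<close> is used at the indices \<open>1..m\<close> only.\<close>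
definition cweno ::
  "real set \<Rightarrow> (nat \<Rightarrow> real) \<Rightarrow> nat \<Rightarrow> real \<Rightarrow> real \<Rightarrow> real poly \<Rightarrow> (nat \<Rightarrow> real poly) \<Rightarrow> real poly" where
  "cweno \<Omega> d m t \<epsilon> Popt P =
     (let Q = cweno_poly d m Popt P
      in \<Sum>k=0..m. smult (cweno_omega \<Omega> d m t \<epsilon> Q k) (Q k))"

end

theory Submission
  imports Defs
begin

text \<open>
  Subtracting \<open>u\<close> from every candidate polynomial and using that the nonlinear weights sum to one
  gives, with \<open>Q\<^sub>0, \<dots>, Q\<^sub>m\<close> the polynomials that the weights combine,
  \<open>u - P\<^sub>r\<^sub>e\<^sub>c = (u - P\<^sub>o\<^sub>p\<^sub>t) + \<Sum>\<^sub>k (\<omega>\<^sub>k - d\<^sub>k) (u - Q\<^sub>k)\<close> (\<open>cweno_error_split\<close>). The first term has the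
  optimal order \<open>G + 1\<close>, and each \<open>u - Q\<^sub>k\<close> has order \<open>g + 1\<close>. Since \<open>G \<le> 2 g\<close>, it is enough that
  \<open>\<omega>\<^sub>k - d\<^sub>k = O(h\<^sup>g)\<close>.

  The weights differ from the linear ones only through differences of the indicators. All \<open>Q\<^sub>k\<close> share
  the jet of \<open>u\<close>: their \<open>l\<close>-th derivatives agree with that of \<open>u\<close> up to \<open>O(h\<^bsup>g+1-l\<^esup>)\<close>, or \<open>O(1)\<close> for \<open>l > g\<close>. Factoring the
  difference of squares therefore bounds the \<open>l\<close>-th summand of \<open>I[Q\<^sub>i] - I[Q\<^sub>j]\<close> by
  \<open>h\<^bsup>2l-1\<^esup> \<sqdot> h \<sqdot> O(h\<^bsup>g+1-l\<^esup>)\<close>, which is \<open>O(h\<^bsup>g+2\<^esup>)\<close> (\<open>jiang_shu_difference\<close>). The indicators are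
  nonnegative, so \<open>I[Q\<^sub>j] + \<epsilon>\<close> is at least of size \<open>h\<^sup>p\<close>; the relative differences of these numbers,
  and with them \<open>\<omega>\<^sub>k - d\<^sub>k\<close>, are \<open>O(h\<^bsup>g+2-p\<^esup>)\<close> (\<open>cweno_omega_accuracy\<close>), where \<open>p \<le> 2\<close>.

  Cells of the stencil that are much smaller than \<open>h\<close> do no harm to the accuracy of the interpolants and
  of their derivatives, because the points of interpolation need not be well separated. Equal cell
  averages force \<open>u\<close> and the interpolant to agree at some point inside each cell of the stencil. These
  points are distinct and lie at distance \<open>O(h)\<close> from the origin, and Rolle's theorem does the rest
  (\<open>interpolates_averages_jet_approx\<close>).
\<close>

section \<open>Smooth functions and derivatives of polynomials\<close>

lemma smooth_DERIV:
  assumes "smooth u"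
  shows "((deriv ^^ n) u has_real_derivative (deriv ^^ Suc n) u x) (at x)"
  using assms by (simp add: smooth_def DERIV_deriv_iff_real_differentiable)

lemma smooth_bounded_on_interval:
  assumes "smooth u"
  shows "\<exists>M\<ge>0. \<forall>x\<in>{a..b}. \<bar>(deriv ^^ n) u x\<bar> \<le> M"
proof -
  have "continuous_on {a..b} ((deriv ^^ n) u)"
    using smooth_DERIV[OF assms] by (intro DERIV_continuous_on) (rule has_field_derivative_at_within)
  then have "bounded ((deriv ^^ n) u ` {a..b})"
    by (intro compact_imp_bounded compact_continuous_image) auto
  then obtain M where "M > 0" "\<forall>y\<in>(deriv ^^ n) u ` {a..b}. norm y \<le> M"
    using bounded_pos by blast
  then show ?thesis
    by (intro exI[of _ M]) auto
qed

lemma pderiv_funpow_eq_0: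
  fixes q :: "real poly"
  assumes "degree q < l"
  shows "(pderiv ^^ l) q = 0"
  using assms
proof (induction l arbitrary: q)
  case (Suc l)
  show ?case
  proof (cases "degree q = 0")
    case True
    then have "pderiv q = 0" by (simp add: pderiv_eq_0_iff)
    moreover have "(pderiv ^^ l) 0 = (0 :: real poly)" by (induction l) auto
    ultimately show ?thesis by (simp add: funpow_swap1)
  next
    case False
    then have "degree (pderiv q) < l" using Suc.prems by (simp add: degree_pderiv)
    then show ?thesis using Suc.IH[of "pderiv q"] by (simp add: funpow_swap1)
  qed
qed simp

lemma pderiv_funpow_sum_smult:
  fixes q :: "'i \<Rightarrow> real poly"
  shows "(pderiv ^^ l) (\<Sum>i\<in>I. smult (c i) (q i)) = (\<Sum>i\<in>I. smult (c i) ((pderiv ^^ l) (q i)))"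
  by (simp add: higher_pderiv_sum higher_pderiv_smult)

section \<open>Accuracy of interpolation of cell averages\<close>

text \<open>
  Rolle's theorem between consecutive zeros. Zeros of the derivative are located strictly to the left
  of the largest zero, so that the one found after adding a new largest zero is different from them.
\<close>
lemma Rolle_finite_zeros:
  fixes f f' :: "real \<Rightarrow> real"
  assumes der: "\<And>x. (f has_real_derivative f' x) (at x)"
    and "finite Z" "Z \<noteq> {}" "\<And>z. z \<in> Z \<Longrightarrow> f z = 0"
  shows "\<exists>Z'\<subseteq>{Min Z..<Max Z}. finite Z' \<and> card Z = Suc (card Z') \<and> (\<forall>z\<in>Z'. f' z = 0)"
  using assms(2-)
proof (induction Z rule: finite_linorder_max_induct)
  case (insert b A)
  show ?case
  proof (cases "A = {}")
    case True
    then show ?thesis by (intro exI[of _ "{}"]) auto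
  next
    case False
    then obtain Z' where Z': "Z' \<subseteq> {Min A..<Max A}" "finite Z'" "card A = Suc (card Z')"
      "\<forall>z\<in>Z'. f' z = 0"
      using insert by auto
    have lt: "Max A < b" using insert False by auto
    have zeros: "f (Max A) = 0" "f b = 0" using insert False by auto
    have "\<exists>z>Max A. z < b \<and> DERIV f z :> 0"
    proof (rule Rolle[OF lt])
      show "continuous_on {Max A..b} f"
        by (rule DERIV_continuous_on[OF has_field_derivative_at_within[OF der]])
      show "f differentiable (at x)" for x using der real_differentiable_def by blast
    qed (use zeros in simp)
    then obtain z where z: "Max A < z" "z < b" "f' z = 0"
      using DERIV_unique[OF der] by blast
    have "Min A \<le> Max A" using insert False by simp
    then have "Min A \<le> b" "Max A \<le> b" using lt by linarith+
    then have "Min (insert b A) = Min A" "Max (insert b A) = b"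
      by (simp_all only: Min_insert[OF \<open>finite A\<close> False] Max_insert[OF \<open>finite A\<close> False]
          min_absorb2 max_absorb1)
    moreover have "z \<notin> Z'" using Z'(1) z(1) by auto
    moreover have "b \<notin> A" using insert by auto
    moreover have "insert z Z' \<subseteq> {Min A..<b}"
      using Z'(1) z(1,2) lt \<open>Min A \<le> Max A\<close> by auto
    ultimately show ?thesis
      using Z'(2-4) z(3) \<open>finite A\<close> by (intro exI[of _ "insert z Z'"]) simp
  qed
qed simp

lemma iterated_Rolle:
  fixes F :: "nat \<Rightarrow> real \<Rightarrow> real"
  assumes der: "\<And>l x. (F l has_real_derivative F (Suc l) x) (at x)"
    and Z: "finite Z" "card Z = Suc n" "Z \<subseteq> {a..b}" "\<And>z. z \<in> Z \<Longrightarrow> F 0 z = 0"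
    and "l \<le> n"
  shows "\<exists>z\<in>{a..b}. F l z = 0"
proof -
  have "\<exists>Z'\<subseteq>{a..b}. finite Z' \<and> card Z' = Suc n - l \<and> (\<forall>z\<in>Z'. F l z = 0)"
    using \<open>l \<le> n\<close>
  proof (induction l)
    case 0
    show ?case using Z by (intro exI[of _ Z]) auto
  next
    case (Suc l)
    then obtain Y where Y: "Y \<subseteq> {a..b}" "finite Y" "card Y = Suc n - l" "\<forall>z\<in>Y. F l z = 0"
      by auto
    then have "Y \<noteq> {}" using Suc.prems by auto
    then obtain Z' where Z': "Z' \<subseteq> {Min Y..<Max Y}" "finite Z'" "card Y = Suc (card Z')"
      "\<forall>z\<in>Z'. F (Suc l) z = 0"
      using Rolle_finite_zeros[OF der, of Y l] Y by auto
    have "Min Y \<in> {a..b}" "Max Y \<in> {a..b}"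
      using Y(1) Min_in[OF Y(2) \<open>Y \<noteq> {}\<close>] Max_in[OF Y(2) \<open>Y \<noteq> {}\<close>] by blast+
    then have "Z' \<subseteq> {a..b}" using Z'(1) by auto
    then show ?case using Z' Y(3) by (intro exI[of _ Z']) auto
  qed
  then obtain Z' where Z': "Z' \<subseteq> {a..b}" "card Z' = Suc n - l" "\<forall>z\<in>Z'. F l z = 0" by blast
  then have "Z' \<noteq> {}" using \<open>l \<le> n\<close> by auto
  then show ?thesis using Z' by blast
qed

text \<open>
  Each of the derivatives of order at most \<open>n\<close> has a zero, so by the mean value theorem every step from
  order \<open>l + 1\<close> down to order \<open>l\<close> costs one factor \<open>b - a\<close>. The bound does not involve the distances
  between the zeros.
\<close>
lemma derivative_bounds_from_zeros:
  fixes F :: "nat \<Rightarrow> real \<Rightarrow> real"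
  assumes der: "\<And>l x. (F l has_real_derivative F (Suc l) x) (at x)"
    and Z: "finite Z" "card Z = Suc n" "Z \<subseteq> {a..b}" "\<And>z. z \<in> Z \<Longrightarrow> F 0 z = 0"
    and M: "\<And>x. x \<in> {a..b} \<Longrightarrow> \<bar>F (Suc n) x\<bar> \<le> M"
    and "l \<le> Suc n" "x \<in> {a..b}"
  shows "\<bar>F l x\<bar> \<le> M * (b - a) ^ (Suc n - l)"
  using \<open>l \<le> Suc n\<close> \<open>x \<in> {a..b}\<close>
proof (induction l arbitrary: x rule: inc_induct)
  case base
  then show ?case using M by simp
next
  case (step l)
  obtain z where z: "z \<in> {a..b}" "F l z = 0"
    using iterated_Rolle[OF der Z, of l] step.hyps by auto
  let ?B = "M * (b - a) ^ (Suc n - Suc l)"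
  have "0 \<le> \<bar>F (Suc l) x\<bar>" by simp
  then have B: "0 \<le> ?B" using step.IH[OF step.prems] by linarith
  have "norm (F l x - F l z) \<le> ?B * norm (x - z)"
  proof (rule field_differentiable_bound[of "{a..b}"])
    show "(F l has_field_derivative F (Suc l) y) (at y within {a..b})" for y
      by (rule has_field_derivative_at_within[OF der])
  qed (use step z in auto)
  also have "\<dots> \<le> ?B * (b - a)"
    using z step.prems B by (intro mult_left_mono) auto
  also have "\<dots> = M * (b - a) ^ (Suc n - l)"
    using step.hyps by (simp add: Suc_diff_le)
  finally show ?case using z by simp
qed

lemma integral_zero_imp_zero:
  fixes f :: "real \<Rightarrow> real"
  assumes "a < b" "continuous_on {a..b} f" "integral {a..b} f = 0"
  shows "\<exists>z\<in>{a<..<b}. f z = 0"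
proof -
  let ?I = "\<lambda>x. integral {a..x} f"
  have der: "(?I has_real_derivative f x) (at x within {a..b})" if "x \<in> {a..b}" for x
    using integral_has_real_derivative[OF assms(2) that] .
  have inner: "(?I has_real_derivative f x) (at x)" if "a < x" "x < b" for x
    using der[of x] at_within_Icc_at[OF that] that by simp
  have "\<exists>z>a. z < b \<and> DERIV ?I z :> 0"
  proof (rule Rolle[OF assms(1)])
    show "continuous_on {a..b} ?I" using der by (rule DERIV_continuous_on)
    show "?I differentiable (at x)" if "a < x" "x < b" for x
      using inner[OF that] real_differentiable_def by blast
  qed (use assms(3) in simp)
  then show ?thesis using DERIV_unique[OF inner] by fastforce
qed

text \<open>
  For a fixed index, an interface is at distance \<open>O(h)\<close> from the origin: it is reached from cell \<open>0\<close> by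
  crossing cells of diameter at most \<open>K * h\<close>, and the half width of cell \<open>0\<close> is also below \<open>K * h\<close>.
\<close>
lemma grid_interfaces_bound:
  assumes "grid K h e" "h > 0"
  shows "\<bar>e j\<bar> \<le> (\<bar>real_of_int j\<bar> + 1) * (K * h)"
proof -
  have mono: "strict_mono e" and e0: "e 0 = - h / 2" and e1: "e 1 = h / 2"
    using assms(1) by (auto simp: grid_def)
  have len: "e (j + 1) - e j \<le> K * h" for j
  proof -
    have "e j \<le> e (j + 1)" using mono by (simp add: strict_mono_less_eq)
    moreover have "diameter (cell e j) \<le> K * h" using assms(1) by (simp add: grid_def)
    ultimately show ?thesis by (simp add: cell_def)
  qed
  have 1: "e (int n) \<le> e 0 + n * (K * h)" for n
  proof (induction n)
    case (Suc n)
    then show ?case using len[of "int n"] by (simp add: algebra_simps)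
  qed simp
  have 2: "e (- int n) \<ge> e 0 - n * (K * h)" for n
  proof (induction n)
    case (Suc n)
    then show ?case using len[of "- int (Suc n)"] by (simp add: algebra_simps)
  qed simp
  have Kh: "h \<le> K * h" using len[of 0] e0 e1 by simp
  have nonneg: "0 \<le> \<bar>real_of_int j\<bar> * (K * h)" for j
    using Kh \<open>h > 0\<close> by (intro mult_nonneg_nonneg) auto
  show ?thesis
  proof (cases "j \<ge> 0")
    case True
    then have "e 0 \<le> e j" using mono by (simp add: strict_mono_less_eq)
    moreover have "e j \<le> e 0 + \<bar>real_of_int j\<bar> * (K * h)" using 1[of "nat j"] True by simp
    ultimately show ?thesis
      using e0 Kh \<open>h > 0\<close> nonneg[of j] unfolding distrib_right mult_1_left abs_le_iff by linarith
  next
    case False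
    then have "e j \<le> e 0" using mono by (simp add: strict_mono_less_eq)
    moreover have "e j \<ge> e 0 - \<bar>real_of_int j\<bar> * (K * h)" using 2[of "nat (- j)"] False by simp
    ultimately show ?thesis
      using e0 Kh \<open>h > 0\<close> nonneg[of j] unfolding distrib_right mult_1_left abs_le_iff by linarith
  qed
qed

lemma equal_average_imp_common_value:
  assumes "strict_mono e" "continuous_on UNIV f" "continuous_on UNIV g"
    and "cell_average (cell e j) f = cell_average (cell e j) g"
  shows "\<exists>z\<in>{e j<..<e (j + 1)}. f z = g z"
proof -
  have lt: "e j < e (j + 1)" using assms(1) by (simp add: strict_mono_less)
  have cont: "continuous_on {e j..e (j + 1)} f" "continuous_on {e j..e (j + 1)} g"
    using assms(2,3) continuous_on_subset by blast+
  have "integral {e j..e (j + 1)} f = integral {e j..e (j + 1)} g"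
    using assms(4) lt by (simp add: cell_average_def cell_def)
  then have "integral {e j..e (j + 1)} (\<lambda>x. f x - g x) = 0"
    using cont by (simp add: integral_diff integrable_continuous_real)
  then show ?thesis
    using integral_zero_imp_zero[OF lt, of "\<lambda>x. f x - g x"] cont
    by (auto intro: continuous_on_diff)
qed

text \<open>
  The whole jet of \<open>u\<close> is approximated to order \<open>n\<close> on the cell of width \<open>h\<close> around \<open>0\<close>. The truncated
  subtraction \<open>n - l\<close> is intended: for \<open>l \<ge> n\<close> the condition says that the error stays bounded.
\<close>
definition jet_approx :: "(real \<Rightarrow> real) \<Rightarrow> nat \<Rightarrow> (real \<Rightarrow> real poly) \<Rightarrow> bool" where
  "jet_approx u n q \<longleftrightarrow> (\<forall>l. \<exists>C\<ge>0. \<forall>h\<in>{0<..1}. \<forall>x\<in>{-h/2..h/2}.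
     \<bar>(deriv ^^ l) u x - poly ((pderiv ^^ l) (q h)) x\<bar> \<le> C * h ^ (n - l))"

text \<open>
  The error \<open>u - q h\<close> has one zero in each open cell of the stencil, hence \<open>n + 1\<close> zeros in an interval
  of radius \<open>R * h\<close> with \<open>R\<close> depending on the stencil and \<open>K\<close> only. Its derivative of order \<open>n + 1\<close> is
  that of \<open>u\<close>, because \<open>q h\<close> has degree at most \<open>n\<close>.
\<close>
theorem interpolates_averages_jet_approx:
  assumes u: "smooth u"
    and grid: "\<And>h. h > 0 \<Longrightarrow> grid K h (e h)"
    and interp: "\<And>h. h > 0 \<Longrightarrow> interpolates_averages (e h) S n u (q h)"
  shows "jet_approx u (Suc n) q"
  unfolding jet_approx_def
proof
  fix l
  have fin: "finite S" "card S = Suc n"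
    using interp[of 1] by (auto simp: interpolates_averages_def)
  have K: "K \<ge> 1"
  proof -
    have g: "grid K 1 (e 1)" using grid[of 1] by simp
    then have "diameter (cell (e 1) 0) \<le> K" by (simp add: grid_def)
    then show ?thesis using g by (simp add: grid_def cell_def)
  qed
  obtain N :: real where N: "N \<ge> 0" "\<And>j. j \<in> S \<Longrightarrow> \<bar>real_of_int j\<bar> \<le> N"
  proof
    show "0 \<le> (\<Sum>j\<in>S. \<bar>real_of_int j\<bar>)" by (simp add: sum_nonneg)
    show "\<bar>real_of_int j\<bar> \<le> (\<Sum>j\<in>S. \<bar>real_of_int j\<bar>)" if "j \<in> S" for j
      using fin that by (intro member_le_sum) auto
  qed
  \<comment> \<open>The interfaces of the cells in \<open>S\<close> have indices of absolute value at most \<open>N + 1\<close>.\<close>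
  define R where "R = (N + 2) * K"
  have R: "R \<ge> 1" unfolding R_def using K N(1) mult_mono[of 1 "N + 2" 1 K] by simp
  \<comment> \<open>For \<open>l > n + 1\<close> the \<open>l\<close>-th derivative of the interpolant vanishes, and a bound on that of \<open>u\<close>
    itself is what is needed.\<close>
  obtain M where M: "M \<ge> 0" "\<And>x. x \<in> {-R..R} \<Longrightarrow> \<bar>(deriv ^^ max l (Suc n)) u x\<bar> \<le> M"
    using smooth_bounded_on_interval[OF u, of "-R" R "max l (Suc n)"] by blast
  have "\<bar>(deriv ^^ l) u x - poly ((pderiv ^^ l) (q h)) x\<bar> \<le> M * (2 * R) ^ (Suc n - l) * h ^ (Suc n - l)"
    if h: "h \<in> {0<..1}" and x: "x \<in> {-h/2..h/2}" for h x
  proof -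
    have hpos: "h > 0" using h by simp
    have mono: "strict_mono (e h)" using grid[OF hpos] by (simp add: grid_def)
    have deg: "degree (q h) \<le> n" using interp[OF hpos] by (simp add: interpolates_averages_def)
    have Rh: "h \<le> R * h" "R * h \<le> R" using R h by (auto simp: mult_le_cancel_left2)
    have sub: "{-(R * h)..R * h} \<subseteq> {-R..R}" using Rh by auto
    have xR: "x \<in> {-(R * h)..R * h}" using x Rh(1) hpos unfolding atLeastAtMost_iff by linarith
    let ?F = "\<lambda>l x. (deriv ^^ l) u x - poly ((pderiv ^^ l) (q h)) x"
    have der: "(?F k has_real_derivative ?F (Suc k) y) (at y)" for k y
      using smooth_DERIV[OF u, of k y] by (auto intro!: derivative_eq_intros)
    have "\<exists>z\<in>{e h j<..<e h (j + 1)}. u z = poly (q h) z" if "j \<in> S" for j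
    proof (rule equal_average_imp_common_value[OF mono])
      show "continuous_on UNIV u"
        using DERIV_continuous_on[OF has_field_derivative_at_within[OF smooth_DERIV[OF u, of 0]]]
        by simp
      show "cell_average (cell (e h) j) u = cell_average (cell (e h) j) (poly (q h))"
        using interp[OF hpos] that by (simp add: interpolates_averages_def)
    qed (intro continuous_intros)
    then obtain z where z: "\<And>j. j \<in> S \<Longrightarrow> z j \<in> {e h j<..<e h (j + 1)}"
        "\<And>j. j \<in> S \<Longrightarrow> u (z j) = poly (q h) (z j)"
      by metis
    have less: "z i < z j" if "i \<in> S" "j \<in> S" "i < j" for i j
    proof -
      have "e h (i + 1) \<le> e h j" using mono that(3) by (simp add: strict_mono_less_eq)
      then show ?thesis using z(1)[OF that(1)] z(1)[OF that(2)] by simp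
    qed
    have "inj_on z S"
      using less by (intro linorder_inj_onI') fastforce
    then have card: "card (z ` S) = Suc n" using fin by (simp add: card_image)
    have "z ` S \<subseteq> {-(R * h)..R * h}"
    proof safe
      fix j assume j: "j \<in> S"
      have "\<bar>e h i\<bar> \<le> R * h" if "\<bar>real_of_int i\<bar> \<le> N + 1" for i
      proof -
        have "(\<bar>real_of_int i\<bar> + 1) * (K * h) \<le> (N + 2) * (K * h)"
          using that K hpos by (intro mult_right_mono) auto
        then show ?thesis using grid_interfaces_bound[OF grid[OF hpos] hpos, of i] 
          by (simp add: R_def mult.assoc)
      qed
      from this[of j] this[of "j + 1"] N(2)[OF j] z(1)[OF j]
      show "z j \<in> {-(R * h)..R * h}" by (auto simp: abs_le_iff)
    qed
    note zeros = finite_imageI[OF fin(1), of z] card this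
    have M': "\<bar>?F (Suc n) y\<bar> \<le> M" if "l \<le> Suc n" "y \<in> {-(R * h)..R * h}" for y
      using M(2)[of y] that sub pderiv_funpow_eq_0[of "q h" "Suc n"] deg by (auto simp: max_def)
    show ?thesis
    proof (cases "l \<le> Suc n")
      case True
      have "\<bar>?F l x\<bar> \<le> M * (R * h - (-(R * h))) ^ (Suc n - l)"
        using derivative_bounds_from_zeros[where F = ?F, OF der zeros _ M'[OF True] True xR] z(2)
        by auto
      then show ?thesis by (simp add: power_mult_distrib mult.assoc)
    next
      case False
      then show ?thesis using M(2)[of x] xR sub pderiv_funpow_eq_0[of "q h" l] deg
        by (auto simp: max_def)
    qed
  qed
  then show "\<exists>C\<ge>0. \<forall>h\<in>{0<..1}. \<forall>x\<in>{-h/2..h/2}.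
      \<bar>(deriv ^^ l) u x - poly ((pderiv ^^ l) (q h)) x\<bar> \<le> C * h ^ (Suc n - l)"
    using M(1) R by (intro exI[of _ "M * (2 * R) ^ (Suc n - l)"]) auto
qed

lemma jet_approx_mono:
  assumes "jet_approx u n q" "n' \<le> n"
  shows "jet_approx u n' q"
  unfolding jet_approx_def
proof
  fix l
  obtain C where C: "C \<ge> 0" "\<And>h x. h \<in> {0<..1} \<Longrightarrow> x \<in> {-h/2..h/2} \<Longrightarrow>
      \<bar>(deriv ^^ l) u x - poly ((pderiv ^^ l) (q h)) x\<bar> \<le> C * h ^ (n - l)"
    using assms(1) unfolding jet_approx_def by meson
  have "C * h ^ (n - l) \<le> C * h ^ (n' - l)" if "h \<in> {0<..1}" for h :: real
    using that assms(2) C(1) by (intro mult_left_mono power_decreasing) auto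
  then show "\<exists>C\<ge>0. \<forall>h\<in>{0<..1}. \<forall>x\<in>{-h/2..h/2}.
      \<bar>(deriv ^^ l) u x - poly ((pderiv ^^ l) (q h)) x\<bar> \<le> C * h ^ (n' - l)"
    using C by (intro exI[of _ C]) (meson order_trans)
qed

lemma jet_approx_affine_combination:
  assumes "finite I" "(\<Sum>i\<in>I. c i) = 1" "\<And>i. i \<in> I \<Longrightarrow> jet_approx u n (q i)"
  shows "jet_approx u n (\<lambda>h. \<Sum>i\<in>I. smult (c i) (q i h))"
  unfolding jet_approx_def
proof
  fix l
  have "\<forall>i\<in>I. \<exists>C\<ge>0. \<forall>h\<in>{0<..1}. \<forall>x\<in>{-h/2..h/2}.
      \<bar>(deriv ^^ l) u x - poly ((pderiv ^^ l) (q i h)) x\<bar> \<le> C * h ^ (n - l)"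
    using assms(3) unfolding jet_approx_def by blast
  then obtain C where C: "\<And>i. i \<in> I \<Longrightarrow> C i \<ge> 0"
    "\<And>i h x. i \<in> I \<Longrightarrow> h \<in> {0<..1} \<Longrightarrow> x \<in> {-h/2..h/2} \<Longrightarrow>
      \<bar>(deriv ^^ l) u x - poly ((pderiv ^^ l) (q i h)) x\<bar> \<le> C i * h ^ (n - l)"
    by metis
  have "\<bar>(deriv ^^ l) u x - poly ((pderiv ^^ l) (\<Sum>i\<in>I. smult (c i) (q i h))) x\<bar>
      \<le> (\<Sum>i\<in>I. \<bar>c i\<bar> * C i) * h ^ (n - l)"
    if "h \<in> {0<..1}" "x \<in> {-h/2..h/2}" for h x
  proof -
    have eq: "(deriv ^^ l) u x - poly ((pderiv ^^ l) (\<Sum>i\<in>I. smult (c i) (q i h))) x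
        = (\<Sum>i\<in>I. c i * ((deriv ^^ l) u x - poly ((pderiv ^^ l) (q i h)) x))"
      using assms(2)
      by (simp add: pderiv_funpow_sum_smult poly_sum right_diff_distrib sum_subtractf
          flip: sum_distrib_right)
    show ?thesis unfolding eq sum_distrib_right
      using C(2) that
      by (intro order_trans[OF sum_abs] sum_mono)
         (auto simp: abs_mult mult.assoc intro!: mult_left_mono)
  qed
  then show "\<exists>C\<ge>0. \<forall>h\<in>{0<..1}. \<forall>x\<in>{-h/2..h/2}.
      \<bar>(deriv ^^ l) u x - poly ((pderiv ^^ l) (\<Sum>i\<in>I. smult (c i) (q i h))) x\<bar> \<le> C * h ^ (n - l)"
    using C(1) by (intro exI[of _ "\<Sum>i\<in>I. \<bar>c i\<bar> * C i"]) (auto intro!: sum_nonneg)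
qed

section \<open>Jiang--Shu indicators\<close>

lemma jiang_shu_eq_sum:
  assumes "degree q \<le> N"
  shows "jiang_shu \<Omega> q = (\<Sum>l=1..N. diameter \<Omega> ^ (2 * l - 1) *
     integral \<Omega> (\<lambda>x. (poly ((pderiv ^^ l) q) x)\<^sup>2))"
proof -
  let ?f = "\<lambda>l. diameter \<Omega> ^ (2 * l - 1) * integral \<Omega> (\<lambda>x. (poly ((pderiv ^^ l) q) x)\<^sup>2)"
  have "?f l = 0" if "l \<in> {1..} - {1..N}" for l
    using that assms pderiv_funpow_eq_0[of q l] by auto
  then have "infsum ?f {1..} = infsum ?f {1..N}"
    by (intro infsum_cong_neutral) auto
  then show ?thesis by (simp add: jiang_shu_def)
qed

lemma jiang_shu_nonneg:
  assumes "bounded \<Omega>"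
  shows "jiang_shu \<Omega> q \<ge> 0"
proof -
  have "integral \<Omega> (\<lambda>x. (poly r x)\<^sup>2) \<ge> 0" for r :: "real poly"
  proof (cases "(\<lambda>x. (poly r x)\<^sup>2) integrable_on \<Omega>")
    case True
    then show ?thesis by (intro integral_nonneg) auto
  qed (simp add: not_integrable_integral)
  then show ?thesis
    using diameter_ge_0[OF assms] by (simp add: jiang_shu_def infsum_nonneg)
qed

text \<open>
  The common limit of the derivatives makes the indicators agree to a higher order than their own
  size \<open>O(h\<^sup>2)\<close>. The exponent is decided by \<open>l = 1\<close>, where the bound \<open>h\<^bsup>2l\<^esup> \<sqdot> h\<^bsup>g+1-l\<^esup>\<close> equals \<open>h\<^bsup>g+2\<^esup>\<close>.
\<close>
lemma jiang_shu_difference: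
  assumes u: "smooth u" and q: "jet_approx u (Suc g) q" and q': "jet_approx u (Suc g) q'"
    and deg: "\<And>h. h > 0 \<Longrightarrow> degree (q h) \<le> N" "\<And>h. h > 0 \<Longrightarrow> degree (q' h) \<le> N"
  shows "\<exists>C\<ge>0. \<forall>h\<in>{0<..1}. \<bar>jiang_shu {-h/2..h/2} (q h) - jiang_shu {-h/2..h/2} (q' h)\<bar> \<le> C * h ^ (g + 2)"
proof -
  let ?T = "\<lambda>q h l. integral {-h/2..h/2} (\<lambda>x. (poly ((pderiv ^^ l) (q h)) x)\<^sup>2)"
  have "\<exists>C\<ge>0. \<forall>h\<in>{0<..1}. \<bar>h ^ (2 * l - 1) * (?T q h l - ?T q' h l)\<bar> \<le> C * h ^ (g + 2)"
    if l: "l \<ge> 1" for l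
  proof -
    obtain A where A: "A \<ge> 0" "\<And>h x. h \<in> {0<..1} \<Longrightarrow> x \<in> {-h/2..h/2} \<Longrightarrow>
        \<bar>(deriv ^^ l) u x - poly ((pderiv ^^ l) (q h)) x\<bar> \<le> A * h ^ (Suc g - l)"
      using q unfolding jet_approx_def by meson
    obtain B where B: "B \<ge> 0" "\<And>h x. h \<in> {0<..1} \<Longrightarrow> x \<in> {-h/2..h/2} \<Longrightarrow>
        \<bar>(deriv ^^ l) u x - poly ((pderiv ^^ l) (q' h)) x\<bar> \<le> B * h ^ (Suc g - l)"
      using q' unfolding jet_approx_def by meson
    obtain M where M: "M \<ge> 0" "\<And>x. x \<in> {-1..1} \<Longrightarrow> \<bar>(deriv ^^ l) u x\<bar> \<le> M"
      using smooth_bounded_on_interval[OF u, of "-1" 1 l] by blast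
    let ?C = "(A + B) * (2 * M + A + B)"
    have "\<bar>h ^ (2 * l - 1) * (?T q h l - ?T q' h l)\<bar> \<le> ?C * h ^ (g + 2)" if h: "h \<in> {0<..1}" for h
    proof -
      let ?f = "\<lambda>x. poly ((pderiv ^^ l) (q h)) x" and ?f' = "\<lambda>x. poly ((pderiv ^^ l) (q' h)) x"
      have pw: "\<bar>(?f x)\<^sup>2 - (?f' x)\<^sup>2\<bar> \<le> ?C * h ^ (Suc g - l)" if x: "x \<in> {-h/2..h/2}" for x
      proof -
        have "\<bar>?f x - ?f' x\<bar> \<le> (A + B) * h ^ (Suc g - l)"
          using A(2)[OF h x] B(2)[OF h x] by (simp add: distrib_right)
        moreover have "h ^ (Suc g - l) \<le> 1" using h by (intro power_le_one) auto
        then have "A * h ^ (Suc g - l) \<le> A" "B * h ^ (Suc g - l) \<le> B"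
          using A(1) B(1) by (auto intro: mult_left_le)
        then have "\<bar>?f x + ?f' x\<bar> \<le> 2 * M + A + B"
          using A(2)[OF h x] B(2)[OF h x] M(2)[of x] x h by auto
        ultimately have "\<bar>?f x - ?f' x\<bar> * \<bar>?f x + ?f' x\<bar> \<le> (A + B) * h ^ (Suc g - l) * (2 * M + A + B)"
          using A(1) B(1) h by (intro mult_mono) auto
        then show ?thesis by (simp add: power2_eq_square square_diff_square_factored abs_mult mult_ac)
      qed
      have eq: "?T q h l - ?T q' h l = integral {-h/2..h/2} (\<lambda>x. (?f x)\<^sup>2 - (?f' x)\<^sup>2)"
        by (intro integral_diff[symmetric] integrable_continuous_real continuous_intros)
      have "norm (?T q h l - ?T q' h l) \<le> ?C * h ^ (Suc g - l) * (h/2 - (-h/2))"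
        unfolding eq using h pw by (intro integral_bound continuous_intros) auto
      then have "\<bar>?T q h l - ?T q' h l\<bar> \<le> ?C * h ^ (Suc g - l) * h" by simp
      then have "\<bar>h ^ (2 * l - 1) * (?T q h l - ?T q' h l)\<bar> \<le> h ^ (2 * l - 1) * (?C * h ^ (Suc g - l) * h)"
        using h by (simp add: abs_mult)
      also have "\<dots> = ?C * h ^ (2 * l - 1 + (Suc g - l) + 1)"
        by (simp add: power_add)
      also have "\<dots> \<le> ?C * h ^ (g + 2)"
        using h l A(1) B(1) M(1) by (intro mult_left_mono power_decreasing) auto
      finally show ?thesis .
    qed
    moreover have "?C \<ge> 0" using A(1) B(1) M(1) by (intro mult_nonneg_nonneg) linarith+
    ultimately show ?thesis by blast
  qed
  then obtain C where C: "\<And>l. l \<ge> 1 \<Longrightarrow> C l \<ge> 0" "\<And>l h. l \<ge> 1 \<Longrightarrow> h \<in> {0<..1} \<Longrightarrow>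
      \<bar>h ^ (2 * l - 1) * (?T q h l - ?T q' h l)\<bar> \<le> C l * h ^ (g + 2)"
    by metis
  have "\<bar>jiang_shu {-h/2..h/2} (q h) - jiang_shu {-h/2..h/2} (q' h)\<bar> \<le> (\<Sum>l=1..N. C l) * h ^ (g + 2)"
    if h: "h \<in> {0<..1}" for h
  proof -
    have "diameter {-h/2..h/2} = h" using h by simp
    then have eq: "jiang_shu {-h/2..h/2} (q h) - jiang_shu {-h/2..h/2} (q' h)
        = (\<Sum>l=1..N. h ^ (2 * l - 1) * (?T q h l - ?T q' h l))"
      using h deg by (simp add: jiang_shu_eq_sum[where N = N] right_diff_distrib sum_subtractf)
    show ?thesis unfolding eq sum_distrib_right
      using C(2) h by (intro order_trans[OF sum_abs] sum_mono) auto
  qed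
  moreover have "(\<Sum>l=1..N. C l) \<ge> 0" using C(1) by (intro sum_nonneg) simp
  ultimately show ?thesis by blast
qed

section \<open>Nonlinear weights\<close>

text \<open>
  Up to the factor \<open>d k\<close>, the normalized weight is the reciprocal of the \<open>d\<close>-average of the ratios
  \<open>(B k / B i) powr t\<close>. All ratios lie between \<open>1 / \<rho>\<close> and \<open>\<rho>\<close> with \<open>\<rho> = (1 + \<eta>) powr t\<close>, and so does
  the reciprocal of their average.
\<close>
lemma normalized_weight_perturbation:
  fixes d B :: "'i \<Rightarrow> real"
  assumes "finite I" "\<And>i. i \<in> I \<Longrightarrow> d i \<ge> 0" "(\<Sum>i\<in>I. d i) = 1"
    and B: "\<And>i. i \<in> I \<Longrightarrow> B i > 0" "\<And>i j. i \<in> I \<Longrightarrow> j \<in> I \<Longrightarrow> B i \<le> (1 + \<eta>) * B j"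
    and "0 \<le> \<eta>" "t \<ge> 0" "k \<in> I"
  shows "\<bar>d k / B k powr t / (\<Sum>i\<in>I. d i / B i powr t) - d k\<bar> \<le> (1 + \<eta>) powr t - 1"
proof -
  let ?\<rho> = "(1 + \<eta>) powr t"
  have \<rho>: "?\<rho> \<ge> 1" using assms by (simp add: ge_one_powr_ge_zero)
  define s where "s = (\<Sum>i\<in>I. d i * (B k powr t / B i powr t))"
  have ratio: "B i powr t \<le> ?\<rho> * B j powr t" if "i \<in> I" "j \<in> I" for i j
    using powr_mono2[OF \<open>t \<ge> 0\<close> _ B(2)[OF that]] B(1) that \<open>0 \<le> \<eta>\<close>
    by (simp add: powr_mult less_imp_le)
  have pos: "B i powr t > 0" if "i \<in> I" for i using B(1)[OF that] by simp
  have "s \<le> (\<Sum>i\<in>I. d i * ?\<rho>)" unfolding s_def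
    using assms(2) ratio[OF \<open>k \<in> I\<close>] pos
    by (intro sum_mono mult_left_mono) (auto simp: divide_le_eq)
  then have s_le: "s \<le> ?\<rho>" using assms(3) by (simp flip: sum_distrib_right)
  have "(\<Sum>i\<in>I. d i * (1 / ?\<rho>)) \<le> s" unfolding s_def
  proof (intro sum_mono mult_left_mono assms(2))
    show "1 / ?\<rho> \<le> B k powr t / B i powr t" if "i \<in> I" for i
    proof -
      have "?\<rho> > 0" using \<rho> by linarith
      then have "1 / ?\<rho> * B i powr t \<le> B k powr t"
        using ratio[OF that \<open>k \<in> I\<close>] by (simp add: pos_divide_le_eq mult.commute)
      then show ?thesis using pos[OF that] by (simp only: pos_le_divide_eq)
    qed
  qed
  then have s_ge: "1 / ?\<rho> \<le> s" using assms(3) by (simp flip: sum_divide_distrib)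
  have "?\<rho> > 0" using \<rho> by linarith
  then have "0 < 1 / ?\<rho>" by (rule divide_pos_pos[OF zero_less_one])
  then have spos: "s > 0" using s_ge by linarith
  have "(\<Sum>i\<in>I. d i / B i powr t) = s / B k powr t"
    using pos[OF \<open>k \<in> I\<close>] by (simp add: s_def sum_divide_distrib)
  then have eq: "d k / B k powr t / (\<Sum>i\<in>I. d i / B i powr t) - d k = d k * (1 / s - 1)"
    using pos[OF \<open>k \<in> I\<close>] by (simp add: right_diff_distrib)
  have "\<bar>1 / s - 1\<bar> \<le> ?\<rho> - 1"
  proof -
    have "1 / s \<le> ?\<rho>"
    proof -
      have "?\<rho> > 0" using \<rho> by linarith
      then show ?thesis using s_ge spos by (simp add: pos_divide_le_eq mult.commute)
    qed
    moreover have "1 / ?\<rho> \<le> 1 / s" using s_le spos by (simp add: frac_le)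
    moreover have "2 - ?\<rho> \<le> 1 / ?\<rho>"
    proof -
      have "(2 - ?\<rho>) * ?\<rho> \<le> 1"
        using zero_le_power2[of "?\<rho> - 1"] by (simp add: power2_eq_square algebra_simps)
      moreover have "?\<rho> > 0" using \<rho> by linarith
      ultimately show ?thesis by (simp only: pos_le_divide_eq)
    qed
    ultimately show ?thesis by linarith
  qed
  moreover have "d k \<le> 1"
    using member_le_sum[of k I d] assms by auto
  ultimately have "d k * \<bar>1 / s - 1\<bar> \<le> 1 * (?\<rho> - 1)"
    using assms(2)[OF \<open>k \<in> I\<close>] by (intro mult_mono) auto
  then show ?thesis
    using assms(2)[OF \<open>k \<in> I\<close>] by (simp only: eq abs_mult abs_of_nonneg mult_1_left)
qed

text \<open>
  A mean value estimate, linear in \<open>\<eta>\<close> on bounded ranges; with it the weights inherit the order in \<open>h\<close>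
  of the relative differences of the indicators.
\<close>
lemma powr_minus_one_le:
  fixes \<eta> c t :: real
  assumes "0 \<le> \<eta>" "\<eta> \<le> c" "t \<ge> 1"
  shows "(1 + \<eta>) powr t - 1 \<le> t * (1 + c) powr (t - 1) * \<eta>"
proof (cases "\<eta> = 0")
  case False
  have "\<exists>z>1. z < 1 + \<eta> \<and> (1 + \<eta>) powr t - 1 powr t = (1 + \<eta> - 1) * (t * z powr (t - 1))"
    using assms False by (intro MVT2) (auto intro!: derivative_eq_intros)
  then obtain z where z: "1 < z" "z < 1 + \<eta>" "(1 + \<eta>) powr t - 1 = \<eta> * (t * z powr (t - 1))"
    by auto
  have "z powr (t - 1) \<le> (1 + c) powr (t - 1)" using z assms by (intro powr_mono2) auto
  then have "\<eta> * (t * z powr (t - 1)) \<le> \<eta> * (t * (1 + c) powr (t - 1))"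
    using assms by (intro mult_left_mono) auto
  then show ?thesis using z(3) by (simp add: mult_ac)
qed simp

text \<open>
  The term \<open>eps * h ^ p\<close> keeps the denominators away from zero where the indicators degenerate, for
  example near critical points of \<open>u\<close>. The price is the loss of \<open>p\<close> orders when absolute differences
  of indicators are turned into relative ones.
\<close>
lemma cweno_omega_accuracy:
  assumes d: "\<And>k. k \<le> m \<Longrightarrow> 0 < d k" "(\<Sum>k=0..m. d k) = 1"
    and "t \<ge> 1" "eps > 0" "p \<le> s" "C \<ge> 0"
    and \<Omega>: "\<And>h. bounded (\<Omega> h)"
    and I: "\<And>h i j. h \<in> {0<..1} \<Longrightarrow> i \<le> m \<Longrightarrow> j \<le> m \<Longrightarrow>
      \<bar>jiang_shu (\<Omega> h) (Q h i) - jiang_shu (\<Omega> h) (Q h j)\<bar> \<le> C * h ^ s"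
  shows "\<exists>C'\<ge>0. \<forall>h\<in>{0<..1}. \<forall>k\<le>m.
    \<bar>cweno_omega (\<Omega> h) d m t (eps * h ^ p) (Q h) k - d k\<bar> \<le> C' * h ^ (s - p)"
proof -
  let ?c = "C / eps"
  let ?C' = "t * (1 + ?c) powr (t - 1) * ?c"
  have "\<bar>cweno_omega (\<Omega> h) d m t (eps * h ^ p) (Q h) k - d k\<bar> \<le> ?C' * h ^ (s - p)"
    if h: "h \<in> {0<..1}" and k: "k \<le> m" for h k
  proof -
    let ?B = "\<lambda>k. jiang_shu (\<Omega> h) (Q h k) + eps * h ^ p"
    let ?\<eta> = "?c * h ^ (s - p)"
    have c: "?c \<ge> 0" using assms by simp
    have \<eta>: "0 \<le> ?\<eta>" "?\<eta> \<le> ?c" 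
      using c h by (auto intro!: mult_nonneg_nonneg mult_left_le power_le_one simp del: times_divide_eq_left)
    have ge: "?B i \<ge> eps * h ^ p" for i using jiang_shu_nonneg[OF \<Omega>, of h "Q h i"] by simp
    have eh: "eps * h ^ p > 0" using h \<open>eps > 0\<close> by simp
    have pos: "?B i > 0" for i using ge[of i] eh by linarith
    have "?B i \<le> (1 + ?\<eta>) * ?B j" if "i \<le> m" "j \<le> m" for i j
    proof -
      have "C * h ^ s = ?\<eta> * (eps * h ^ p)"
        using \<open>eps > 0\<close> \<open>p \<le> s\<close> by (simp flip: power_add)
      also have "\<dots> \<le> ?\<eta> * ?B j" using ge \<eta> by (intro mult_left_mono)
      finally show ?thesis using I[OF h that] by (simp add: distrib_right)
    qed
    then have "\<bar>d k / ?B k powr t / (\<Sum>i\<in>{0..m}. d i / ?B i powr t) - d k\<bar> \<le> (1 + ?\<eta>) powr t - 1"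
      using d pos \<eta>(1) \<open>t \<ge> 1\<close> k
      by (intro normalized_weight_perturbation) (auto intro: less_imp_le)
    also have "\<dots> \<le> t * (1 + ?c) powr (t - 1) * ?\<eta>"
      using \<eta> \<open>t \<ge> 1\<close> by (intro powr_minus_one_le)
    finally show ?thesis by (simp add: cweno_omega_def cweno_alpha_def mult_ac)
  qed
  moreover have "?C' \<ge> 0" using assms by simp
  ultimately show ?thesis by (intro exI[of _ ?C']) blast
qed

lemma cweno_omega_sum:
  assumes "\<And>k. k \<le> m \<Longrightarrow> 0 < d k" "\<epsilon> > 0" "bounded \<Omega>"
  shows "(\<Sum>k=0..m. cweno_omega \<Omega> d m t \<epsilon> Q k) = 1"
proof -
  have "(\<Sum>i=0..m. cweno_alpha \<Omega> d t \<epsilon> Q i) > 0"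
  proof (rule sum_pos)
    show "cweno_alpha \<Omega> d t \<epsilon> Q i > 0" if "i \<in> {0..m}" for i
      using assms(1)[of i] that jiang_shu_nonneg[OF assms(3), of "Q i"] assms(2)
      by (simp add: cweno_alpha_def)
  qed auto
  then show ?thesis by (simp add: cweno_omega_def flip: sum_divide_distrib)
qed

section \<open>Accuracy of the reconstruction\<close>

lemma cweno_poly_combination:
  assumes "d 0 \<noteq> 0"
  shows "(\<Sum>k=0..m. smult (d k) (cweno_poly d m Popt P k)) = Popt"
proof -
  have "(\<Sum>k=0..m. smult (d k) (cweno_poly d m Popt P k))
      = smult (d 0) (cweno_poly d m Popt P 0) + (\<Sum>k=1..m. smult (d k) (cweno_poly d m Popt P k))"
    by (simp add: sum.atLeast_Suc_atMost)
  also have "(\<Sum>k=1..m. smult (d k) (cweno_poly d m Popt P k)) = (\<Sum>k=1..m. smult (d k) (P k))"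
    by (intro sum.cong) (auto simp: cweno_poly_def)
  finally show ?thesis using assms by (simp add: cweno_poly_def)
qed

text \<open>
  The coefficients \<open>1 / d 0\<close> and \<open>- d i / d 0\<close> that define the polynomial with index \<open>0\<close> sum to one, so
  it approximates \<open>u\<close> as well as the polynomials it is made of.
\<close>
lemma jet_approx_cweno_poly:
  assumes d: "d 0 \<noteq> 0" "(\<Sum>k=0..m. d k) = 1"
    and Popt: "jet_approx u n Popt" and P: "\<And>k. k \<in> {1..m} \<Longrightarrow> jet_approx u n (\<lambda>h. P h k)"
    and "k \<le> m"
  shows "jet_approx u n (\<lambda>h. cweno_poly d m (Popt h) (P h) k)"
proof (cases "k = 0")
  case True
  let ?c = "\<lambda>i. if i = 0 then 1 / d 0 else - d i / d 0"
  let ?q = "\<lambda>i h. if i = 0 then Popt h else P h i"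
  have "1 / d 0 - (\<Sum>i=1..m. d i) / d 0 = 1"
    using d by (simp add: sum.atLeast_Suc_atMost field_simps)
  then have "(\<Sum>i=0..m. ?c i) = 1"
    by (simp add: sum.atLeast_Suc_atMost sum_negf sum_divide_distrib)
  then have "jet_approx u n (\<lambda>h. \<Sum>i\<in>{0..m}. smult (?c i) (?q i h))"
  proof (intro jet_approx_affine_combination)
    show "jet_approx u n (?q i)" if "i \<in> {0..m}" for i
      using Popt P[of i] that by (cases "i = 0") auto
  qed auto
  moreover have "(\<Sum>i=0..m. smult (?c i) (?q i h)) = cweno_poly d m (Popt h) (P h) 0" for h
  proof -
    have "(\<Sum>i=1..m. smult (?c i) (?q i h)) = - smult (1 / d 0) (\<Sum>i=1..m. smult (d i) (P h i))"
      by (rule poly_eqI) (auto simp: coeff_sum sum_distrib_left simp flip: sum_negf intro!: sum.cong)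
    then show ?thesis
      by (simp add: sum.atLeast_Suc_atMost cweno_poly_def smult_diff_right)
  qed
  ultimately show ?thesis using True by simp
next
  case False
  then show ?thesis using P[of k] \<open>k \<le> m\<close> by (simp add: cweno_poly_def)
qed

lemma degree_cweno_poly_le:
  assumes "degree Popt \<le> N" "\<And>i. i \<in> {1..m} \<Longrightarrow> degree (P i) \<le> N" "k \<le> m"
  shows "degree (cweno_poly d m Popt P k) \<le> N"
proof (cases "k = 0")
  case True
  have "degree (\<Sum>i=1..m. smult (d i) (P i)) \<le> N"
    using assms(2) by (intro degree_sum_le) (auto intro: order_trans[OF degree_smult_le])
  then show ?thesis using True assms(1)
    by (auto simp: cweno_poly_def intro!: degree_diff_le order_trans[OF degree_smult_le])
next
  case False
  then show ?thesis using assms by (auto simp: cweno_poly_def)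
qed

text \<open>
  With the linear weights the combination is \<open>Popt\<close>, and both families of weights sum to one. Hence only
  the weight errors, multiplied by the errors of the candidate polynomials, add to the error of \<open>Popt\<close>.
\<close>
lemma cweno_error_split:
  fixes P :: "nat \<Rightarrow> real poly" and Popt :: "real poly"
  assumes "\<And>k. k \<le> m \<Longrightarrow> 0 < d k" "(\<Sum>k=0..m. d k) = 1" "\<epsilon> > 0" "bounded \<Omega>"
  defines "Q \<equiv> cweno_poly d m Popt P"
  shows "v - poly (cweno \<Omega> d m t \<epsilon> Popt P) x = (v - poly Popt x) +
    (\<Sum>k=0..m. (cweno_omega \<Omega> d m t \<epsilon> Q k - d k) * (v - poly (Q k) x))"
proof -
  let ?w = "cweno_omega \<Omega> d m t \<epsilon> Q"
  have "poly Popt x = (\<Sum>k=0..m. d k * poly (Q k) x)"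
    using cweno_poly_combination[of d m Popt P] assms(1)[of 0]
    by (metis (no_types, lifting) Q_def le0 less_irrefl poly_smult poly_sum sum.cong)
  moreover have "poly (cweno \<Omega> d m t \<epsilon> Popt P) x = (\<Sum>k=0..m. ?w k * poly (Q k) x)"
    by (simp add: cweno_def Q_def Let_def poly_sum)
  moreover have "(\<Sum>k=0..m. ?w k) = 1" using cweno_omega_sum assms by blast
  ultimately show ?thesis using assms(2)
    by (simp add: left_diff_distrib right_diff_distrib sum_subtractf flip: sum_distrib_right)
qed

theorem proposition1:
  fixes g G m p :: nat
    and d :: "nat \<Rightarrow> real"
    and t eps K :: real
    and e :: "real \<Rightarrow> int \<Rightarrow> real"
    and Sopt :: "int set"
    and S :: "nat \<Rightarrow> int set"
    and u :: "real \<Rightarrow> real"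
    and Popt :: "real \<Rightarrow> real poly"
    and P :: "real \<Rightarrow> nat \<Rightarrow> real poly"
  assumes "g < G" and "m \<ge> 1"
    and "\<And>k. k \<le> m \<Longrightarrow> 0 < d k \<and> d k \<le> 1" and "(\<Sum>k=0..m. d k) = 1"
    and "t \<ge> 2" and "eps > 0" and "p \<in> {1, 2}"
    and "\<And>h. h > 0 \<Longrightarrow> grid K h (e h)"
    and "0 \<in> Sopt" and "\<And>r. r \<in> {1..m} \<Longrightarrow> S r \<subseteq> Sopt"
    and "smooth u"
    and "\<And>h. h > 0 \<Longrightarrow> interpolates_averages (e h) Sopt G u (Popt h)"
    and "\<And>h r. h > 0 \<Longrightarrow> r \<in> {1..m} \<Longrightarrow> interpolates_averages (e h) (S r) g u (P h r)"
    and "G \<le> 2 * g"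
  shows "\<exists>C. \<forall>\<^sub>F h in at_right 0. \<forall>x\<in>cell (e h) 0.
           \<bar>u x - poly (cweno (cell (e h) 0) d m t (eps * h ^ p) (Popt h) (P h)) x\<bar> \<le> C * h ^ (G + 1)"
proof -
  define Q where "Q h = cweno_poly d m (Popt h) (P h)" for h
  have d: "\<And>k. k \<le> m \<Longrightarrow> 0 < d k" "(\<Sum>k=0..m. d k) = 1" using assms(3,4) by auto
  have cell0: "cell (e h) 0 = {-h/2..h/2}" if "h > 0" for h
    using assms(8)[OF that] by (simp add: grid_def cell_def)
  have Popt: "jet_approx u (Suc G) Popt"
    using interpolates_averages_jet_approx assms(8,11,12) by blast
  have P: "jet_approx u (Suc g) (\<lambda>h. P h r)" if "r \<in> {1..m}" for r
    using interpolates_averages_jet_approx[OF assms(11,8), of "S r" g "\<lambda>h. P h r"] assms(13) that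
    by blast
  have Q: "jet_approx u (Suc g) (\<lambda>h. Q h k)" if "k \<le> m" for k
    unfolding Q_def using d(1)[of 0] d(2) P that \<open>g < G\<close>
    by (intro jet_approx_cweno_poly jet_approx_mono[OF Popt]) auto
  have deg: "degree (Q h k) \<le> G" if "h > 0" "k \<le> m" for h k
    unfolding Q_def
  proof (rule degree_cweno_poly_le)
    show "degree (Popt h) \<le> G" using assms(12) that by (simp add: interpolates_averages_def)
    show "degree (P h i) \<le> G" if "i \<in> {1..m}" for i
      using assms(13)[OF \<open>h > 0\<close> that] \<open>g < G\<close> by (simp add: interpolates_averages_def)
  qed (use that in auto)
  have "\<forall>i\<in>{..m}. \<forall>j\<in>{..m}. \<exists>C\<ge>0. \<forall>h\<in>{0<..1}.
      \<bar>jiang_shu {-h/2..h/2} (Q h i) - jiang_shu {-h/2..h/2} (Q h j)\<bar> \<le> C * h ^ (g + 2)"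
    using jiang_shu_difference[OF assms(11) Q Q deg deg] by blast
  then obtain D where D: "\<And>i j. i \<le> m \<Longrightarrow> j \<le> m \<Longrightarrow> D i j \<ge> 0"
    "\<And>h i j. i \<le> m \<Longrightarrow> j \<le> m \<Longrightarrow> h \<in> {0<..1} \<Longrightarrow>
      \<bar>jiang_shu {-h/2..h/2} (Q h i) - jiang_shu {-h/2..h/2} (Q h j)\<bar> \<le> D i j * h ^ (g + 2)"
    by (metis atMost_iff)
  define C where "C = (\<Sum>i\<le>m. \<Sum>j\<le>m. D i j)"
  have DC: "D i j \<le> C" if "i \<le> m" "j \<le> m" for i j
  proof -
    have "D i j \<le> (\<Sum>j\<le>m. D i j)" using that D(1) by (intro member_le_sum) auto
    also have "\<dots> \<le> C" unfolding C_def
      using that D(1) by (intro member_le_sum[of i _ "\<lambda>i. \<Sum>j\<le>m. D i j"] sum_nonneg) auto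
    finally show ?thesis .
  qed
  have "C \<ge> 0" using DC[of 0 0] D(1)[of 0 0] by simp
  have "\<bar>jiang_shu {-h/2..h/2} (Q h i) - jiang_shu {-h/2..h/2} (Q h j)\<bar> \<le> C * h ^ (g + 2)"
    if "h \<in> {0<..1}" "i \<le> m" "j \<le> m" for h i j
  proof -
    have "h ^ (g + 2) \<ge> 0" using that(1) by simp
    then have "D i j * h ^ (g + 2) \<le> C * h ^ (g + 2)" by (rule mult_right_mono[OF DC[OF that(2,3)]])
    then show ?thesis using D(2)[OF that(2,3,1)] by linarith
  qed
  then obtain W where W: "W \<ge> 0" "\<And>h k. h \<in> {0<..1} \<Longrightarrow> k \<le> m \<Longrightarrow>
      \<bar>cweno_omega {-h/2..h/2} d m t (eps * h ^ p) (Q h) k - d k\<bar> \<le> W * h ^ (g + 2 - p)"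
    using cweno_omega_accuracy[OF d, of t eps p "g + 2" C "\<lambda>h. {-h/2..h/2}" Q] assms(5-7) \<open>C \<ge> 0\<close>
    by auto
  obtain A where A: "A \<ge> 0" "\<And>h x. h \<in> {0<..1} \<Longrightarrow> x \<in> {-h/2..h/2} \<Longrightarrow>
      \<bar>(deriv ^^ 0) u x - poly ((pderiv ^^ 0) (Popt h)) x\<bar> \<le> A * h ^ (Suc G - 0)"
    using Popt unfolding jet_approx_def by meson
  have "\<forall>k\<in>{..m}. \<exists>B\<ge>0. \<forall>h\<in>{0<..1}. \<forall>x\<in>{-h/2..h/2}. \<bar>u x - poly (Q h k) x\<bar> \<le> B * h ^ (g + 1)"
    using Q[unfolded jet_approx_def, rule_format, of _ 0] by auto
  then obtain B where B: "\<And>k. k \<le> m \<Longrightarrow> B k \<ge> 0" "\<And>k h x. k \<le> m \<Longrightarrow> h \<in> {0<..1} \<Longrightarrow>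
      x \<in> {-h/2..h/2} \<Longrightarrow> \<bar>u x - poly (Q h k) x\<bar> \<le> B k * h ^ (g + 1)"
    by (metis atMost_iff)
  have "\<bar>u x - poly (cweno (cell (e h) 0) d m t (eps * h ^ p) (Popt h) (P h)) x\<bar>
      \<le> (A + (\<Sum>k=0..m. W * B k)) * h ^ (G + 1)"
    if h: "h \<in> {0<..1}" and x: "x \<in> cell (e h) 0" for h x
  proof -
    let ?w = "cweno_omega {-h/2..h/2} d m t (eps * h ^ p) (Q h)"
    have cell: "cell (e h) 0 = {-h/2..h/2}" using cell0 h by simp
    have x': "x \<in> {-h/2..h/2}" using x cell by simp
    have eh: "eps * h ^ p > 0" using h \<open>eps > 0\<close> by simp
    have "\<bar>(?w k - d k) * (u x - poly (Q h k) x)\<bar> \<le> W * B k * h ^ (G + 1)" if k: "k \<le> m" for k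
    proof -
      have "\<bar>(?w k - d k) * (u x - poly (Q h k) x)\<bar> \<le> (W * h ^ (g + 2 - p)) * (B k * h ^ (g + 1))"
        unfolding abs_mult using W B(2)[OF k h x'] h k by (intro mult_mono) auto
      also have "\<dots> = W * B k * h ^ ((g + 2 - p) + (g + 1))" by (simp only: power_add mult_ac)
      \<comment> \<open>The exponent is at least \<open>2 * g + 1\<close>, as \<open>p \<le> 2\<close>.\<close>
      also have "\<dots> \<le> W * B k * h ^ (G + 1)"
        using W(1) B(1)[OF k] h assms(7,14) by (intro mult_left_mono power_decreasing) auto
      finally show ?thesis .
    qed
    then have "\<bar>\<Sum>k=0..m. (?w k - d k) * (u x - poly (Q h k) x)\<bar> \<le> (\<Sum>k=0..m. W * B k * h ^ (G + 1))"
      by (intro order_trans[OF sum_abs] sum_mono) auto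
    moreover have "u x - poly (cweno (cell (e h) 0) d m t (eps * h ^ p) (Popt h) (P h)) x
        = (u x - poly (Popt h) x) + (\<Sum>k=0..m. (?w k - d k) * (u x - poly (Q h k) x))"
      unfolding cell Q_def by (rule cweno_error_split[OF d eh bounded_closed_interval])
    ultimately show ?thesis
      using A(2)[OF h x'] by (simp add: distrib_right sum_distrib_right)
  qed
  moreover have "\<forall>\<^sub>F h :: real in at_right 0. h \<in> {0<..1}"
    by (auto simp: eventually_at_right_field intro: exI[of _ 1])
  ultimately show ?thesis
    by (intro exI[of _ "A + (\<Sum>k=0..m. W * B k)"]) (auto elim!: eventually_mono)
qed

end
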